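(* Consider the generalized Riemann problem for the 1D ten-moment equations with source in the acoustic case. Then $$\left(\tfrac{\partial u_2}{\partial t}\right)_{\ast\ast}=\left(\tfrac{\mathcal D u_2}{\mathcal D t}\right)_{\ast\ast}+\frac{u_{1,\ast}}{p_{11,\ast}}\left[\left(\tfrac{\mathcal D p_{12}}{\mathcal D t}\right)_{\ast\ast}-\frac{2p_{12,\ast}}{3p_{11,\ast}}\left(\tfrac{\mathcal D p_{11}}{\mathcal D t}\right)_\ast\right],\qquad\left(\tfrac{\partial p_{12}}{\partial t}\right)_{\ast\ast}=\left(\tfrac{\mathcal D p_{12}}{\mathcal D t}\right)_{\ast\ast}+\rho_\ast u_{1,\ast}\left(\tfrac{\mathcal D u_2}{\mathcal D t}\right)_{\ast\ast},$$ and for $K=L,R$ $$\left(\tfrac{\partial p_{22}}{\partial t}\right)_{\ast\ast K}=\left(\tfrac{\mathcal D p_{22}}{\mathcal D t}\right)_{\ast\ast}-u_{1,\ast}\left(\tfrac{\partial p_{22}}{\partial x}\right)_{\ast\ast K},\qquad\left(\tfrac{\mathcal D p_{22}}{\mathcal D t}\right)_{\ast\ast}=\frac{p_{11,\ast}p_{22,\ast}-4p_{12,\ast}^2}{3p_{11,\ast}^2}\left(\tfrac{\mathcal D p_{11}}{\mathcal D t}\right)_\ast+\frac{2p_{12,\ast}}{p_{11,\ast}}\left(\tfrac{\mathcal D p_{12}}{\mathcal D t}\right)_{\ast\ast},$$ where $$\left(\tfrac{\mathcal D u_2}{\mathcal D t}\right)_{\ast\ast}=\tfrac12\left[\left(\tfrac{\mathcal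 D u_2}{\mathcal D t}\right)_{\ast L}+\left(\tfrac{\mathcal D u_2}{\mathcal D t}\right)_{\ast R}+\tfrac{c_\ast}{\sqrt3p_{11,\ast}}\left(\left(\tfrac{\mathcal D p_{12}}{\mathcal D t}\right)_{\ast L}-\left(\tfrac{\mathcal D p_{12}}{\mathcal D t}\right)_{\ast R}\right)\right],$$ $$\left(\tfrac{\mathcal D p_{12}}{\mathcal D t}\right)_{\ast\ast}=\tfrac{\sqrt3p_{11,\ast}}{2c_\ast}\left[\left(\tfrac{\mathcal D u_2}{\mathcal D t}\right)_{\ast L}-\left(\tfrac{\mathcal D u_2}{\mathcal D t}\right)_{\ast R}+\tfrac{c_\ast}{\sqrt3p_{11,\ast}}\left(\left(\tfrac{\mathcal D p_{12}}{\mathcal D t}\right)_{\ast L}+\left(\tfrac{\mathcal D p_{12}}{\mathcal D t}\right)_{\ast R}\right)\right],$$ $$\left(\tfrac{\partial p_{22}}{\partial x}\right)_{\ast\ast L}=\tfrac{\sqrt3}{c_\ast}\left[\left(\tfrac{\mathcal D p_{22}}{\mathcal D t}\right)_{\ast\ast}-\left(\tfrac{\mathcal D p_{22}}{\mathcal D t}\right)_{\ast L}\right]+\left(\tfrac{\partial p_{22}}{\partial x}\right)_{\ast L},\qquad \left(\tfrac{\partial p_{22}}{\partial x}\right)_{\ast\ast R}=\left(\tfrac{\partial p_{22}}{\partial x}\right)_{\ast R}+\tfrac{\sqrt3}{c_\ast}\left[\left(\tfrac{\mathcal D p_{22}}{\mathcal D t}\right)_{\ast R}-\left(\tfrac{\mathcal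 D p_{22}}{\mathcal D t}\right)_{\ast\ast}\right],$$ and $\left(\frac{\mathcal D p_{11}}{\mathcal D t}\right)_\ast=\frac{3p_{11,\ast}}{2c_\ast}\left[\frac1{\rho_\ast}(p_{11,R}'-p_{11,L}')-c_\ast(u_{1,L}'+u_{1,R}')\right]$.
   Context: **System.** $\mathbf V=(\rho,u_1,u_2,p_{11},p_{12},p_{22})^\top$ with $\rho>0$, $p_{11}>0$, $p_{11}p_{22}-p_{12}^2>0$; $W(x)$ is a given $C^1$ potential; $c=\sqrt{3p_{11}/\rho}$; $\frac{\mathcal D}{\mathcal D t}=\partial_t+u_1\partial_x$. Smooth solutions satisfy: $\frac{\mathcal D\rho}{\mathcal D t}+\rho\partial_xu_1=0$; $\frac{\mathcal D u_1}{\mathcal D t}+\frac1\rho\partial_xp_{11}=-\frac12W_x$; $\frac{\mathcal D u_2}{\mathcal D t}+\frac1\rho\partial_xp_{12}=0$; $\frac{\mathcal D p_{11}}{\mathcal D t}+3p_{11}\partial_xu_1=0$; $\frac{\mathcal D p_{12}}{\mathcal D t}+2p_{12}\partial_xu_1+p_{11}\partial_xu_2=0$; $\frac{\mathcal D p_{22}}{\mathcal D t}+p_{22}\partial_xu_1+2p_{12}\partial_xu_2=0$. **Generalized Riemann problem, acoustic case.** Initial data $\mathbf V_L+x\mathbf V_L'$ for $x<0$, $\mathbf V_R+x\mathbf V_R'$ for $x>0$, with constant vectors $\mathbf V_K=(\rho_K,u_{1,K},u_{2,K},p_{11,K},p_{12,K},p_{22,K})^\top$, $\mathbf V_K'=(\rho_K',u_{1,K}',u_{2,K}',p_{11,K}',p_{12,K}',p_{22,K}')^\top$,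 where $\mathbf V_L=\mathbf V_R=:\mathbf V_\ast=(\rho_\ast,u_{1,\ast},u_{2,\ast},p_{11,\ast},p_{12,\ast},p_{22,\ast})^\top$ but $\mathbf V_L'\neq\mathbf V_R'$; $c_\ast=\sqrt{3p_{11,\ast}/\rho_\ast}$. Only linear (acoustic) waves leave the origin: the solution is continuous near $(0,0)$, $0\le t\ll1$, and smooth (with derivatives having limits at $(0,0)$) in the regions separated by smooth characteristic curves from the origin with speeds $u_1-c$ (1-wave), $u_1-\frac c{\sqrt3}$ (2-wave), $u_1$ (contact), $u_1+\frac c{\sqrt3}$ (5-wave), $u_1+c$ (6-wave). The four regions between consecutive curves are, from left to right, $\ast L,\ast\ast L,\ast\ast R,\ast R$; a region subscript denotes the limit at $(0,0)$ from that region. The limit of $\frac{\mathcal D p_{11}}{\mathcal D t}$ is the same in all four regions (subscript $\ast$); the limits of $\frac{\mathcal D u_2}{\mathcal D t},\frac{\mathcal D p_{12}}{\mathcal D t},\frac{\mathcal D p_{22}}{\mathcal D t},\partial_tu_2,\partial_tp_{12}$ are the same in $\ast\ast L$ and $\ast\ast R$ (subscript $\ast\ast$). **Values in $\ast L,\ast R$** (expressed by the data): $(\frac{\mathcal D u_2}{\mathcal D t})_{\ast L}=-\frac{p_{12,L}'}{\rho_L}-\frac{c_\ast p_{12,L}}{p_{11,\ast}}u_{1,L}'-\frac{p_{12,\ast}c_\ast}{3p_{11,\ast}^2}(\frac{\mathcal D p_{11}}{\mathcal D t})_\ast$, $(\frac{\mathcal D u_2}{\mathcal D t})_{\ast R}=-\frac{p_{12,R}'}{\rho_R}+\frac{c_\ast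 p_{12,R}}{p_{11,\ast}}u_{1,R}'+\frac{p_{12,\ast}c_\ast}{3p_{11,\ast}^2}(\frac{\mathcal D p_{11}}{\mathcal D t})_\ast$, $(\frac{\mathcal D p_{12}}{\mathcal D t})_{\ast K}=\frac{p_{12,\ast}}{p_{11,\ast}}(\frac{\mathcal D p_{11}}{\mathcal D t})_\ast+p_{12,K}u_{1,K}'-p_{11,K}u_{2,K}'$, $(\frac{\mathcal D p_{22}}{\mathcal D t})_{\ast K}=\frac{p_{11,\ast}p_{22,\ast}-4p_{12,\ast}^2}{3p_{11,\ast}^2}(\frac{\mathcal D p_{11}}{\mathcal D t})_\ast+\frac{2p_{12,\ast}}{p_{11,\ast}}(\frac{\mathcal D p_{12}}{\mathcal D t})_{\ast K}$, $(\frac{\partial p_{22}}{\partial x})_{\ast L}=\frac1{c_\ast}[(\frac{\mathcal D p_{22}}{\mathcal D t})_{\ast L}+p_{22,L}u_{1,L}'+2p_{12,L}u_{2,L}'+c_\ast p_{22,L}']$, $(\frac{\partial p_{22}}{\partial x})_{\ast R}=\frac1{c_\ast}[-p_{22,R}u_{1,R}'-2p_{12,R}u_{2,R}'+c_\ast p_{22,R}'-(\frac{\mathcal D p_{22}}{\mathcal D t})_{\ast R}]$. *)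

theory Defs
  imports "HOL-Analysis.Analysis"
begin

type_synonym state = "real ^ 6"

abbreviation rho :: "state \<Rightarrow> real" where "rho v \<equiv> v $ 1"
abbreviation u1 :: "state \<Rightarrow> real" where "u1 v \<equiv> v $ 2"
abbreviation u2 :: "state \<Rightarrow> real" where "u2 v \<equiv> v $ 3"
abbreviation p11 :: "state \<Rightarrow> real" where "p11 v \<equiv> v $ 4"
abbreviation p12 :: "state \<Rightarrow> real" where "p12 v \<equiv> v $ 5"
abbreviation p22 :: "state \<Rightarrow> real" where "p22 v \<equiv> v $ 6"

definition admissible :: "state \<Rightarrow> bool" where
  "admissible v \<longleftrightarrow> rho v > 0 \<and> p11 v > 0 \<and> p11 v * p22 v - (p12 v)\<^sup>2 > 0"

definition sound_speed :: "state \<Rightarrow> real" where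
  "sound_speed v = sqrt (3 * p11 v / rho v)"

text \<open>Fields are written V t x, time first. The operators below differentiate the scalar
  quantity q (a function of the state, such as a component) along the field V.\<close>

definition d_t :: "(real \<Rightarrow> real \<Rightarrow> state) \<Rightarrow> (state \<Rightarrow> real) \<Rightarrow> real \<Rightarrow> real \<Rightarrow> real" where
  "d_t V q t x = deriv (\<lambda>s. q (V s x)) t"

definition d_x :: "(real \<Rightarrow> real \<Rightarrow> state) \<Rightarrow> (state \<Rightarrow> real) \<Rightarrow> real \<Rightarrow> real \<Rightarrow> real" where
  "d_x V q t x = deriv (\<lambda>y. q (V t y)) x"

definition material :: "(real \<Rightarrow> real \<Rightarrow> state) \<Rightarrow> (state \<Rightarrow> real) \<Rightarrow> real \<Rightarrow> real \<Rightarrow> real" where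
  "material V q t x = d_t V q t x + u1 (V t x) * d_x V q t x"

definition ten_moment_at :: "(real \<Rightarrow> real) \<Rightarrow> (real \<Rightarrow> real \<Rightarrow> state) \<Rightarrow> real \<Rightarrow> real \<Rightarrow> bool" where
  "ten_moment_at W V t x \<longleftrightarrow>
     material V rho t x + rho (V t x) * d_x V u1 t x = 0 \<and>
     material V u1 t x + 1 / rho (V t x) * d_x V p11 t x = - (1/2) * deriv W x \<and>
     material V u2 t x + 1 / rho (V t x) * d_x V p12 t x = 0 \<and>
     material V p11 t x + 3 * p11 (V t x) * d_x V u1 t x = 0 \<and>
     material V p12 t x + 2 * p12 (V t x) * d_x V u1 t x + p11 (V t x) * d_x V u2 t x = 0 \<and>
     material V p22 t x + p22 (V t x) * d_x V u1 t x + 2 * p12 (V t x) * d_x V u2 t x = 0"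

datatype wave = Wave1 | Wave2 | Contact | Wave5 | Wave6

primrec wave_speed :: "wave \<Rightarrow> state \<Rightarrow> real" where
  "wave_speed Wave1 v = u1 v - sound_speed v"
| "wave_speed Wave2 v = u1 v - sound_speed v / sqrt 3"
| "wave_speed Contact v = u1 v"
| "wave_speed Wave5 v = u1 v + sound_speed v / sqrt 3"
| "wave_speed Wave6 v = u1 v + sound_speed v"

datatype region = RegL | StarL | StarStarL | StarStarR | StarR | RegR

text \<open>The solution lives on the half-neighbourhood 0 <= t < T, -r < x < r of the origin;
  X w is the characteristic curve of wave w. The regions are open, in particular t > 0.\<close>

primrec region_set :: "real \<Rightarrow> real \<Rightarrow> (wave \<Rightarrow> real \<Rightarrow> real) \<Rightarrow> region \<Rightarrow> (real \<times> real) set" where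
  "region_set T r X RegL = {(t, x). 0 < t \<and> t < T \<and> - r < x \<and> x < X Wave1 t}"
| "region_set T r X StarL = {(t, x). 0 < t \<and> t < T \<and> X Wave1 t < x \<and> x < X Wave2 t}"
| "region_set T r X StarStarL = {(t, x). 0 < t \<and> t < T \<and> X Wave2 t < x \<and> x < X Contact t}"
| "region_set T r X StarStarR = {(t, x). 0 < t \<and> t < T \<and> X Contact t < x \<and> x < X Wave5 t}"
| "region_set T r X StarR = {(t, x). 0 < t \<and> t < T \<and> X Wave5 t < x \<and> x < X Wave6 t}"
| "region_set T r X RegR = {(t, x). 0 < t \<and> t < T \<and> X Wave6 t < x \<and> x < r}"

definition C1_field_on :: "(real \<times> real) set \<Rightarrow> (real \<Rightarrow> real \<Rightarrow> state) \<Rightarrow> bool" where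
  "C1_field_on S V \<longleftrightarrow>
     (\<forall>z\<in>S. (\<lambda>(t, x). V t x) differentiable (at z)) \<and>
     (\<forall>i. continuous_on S (\<lambda>(t, x). d_t V (\<lambda>v. v $ i) t x) \<and>
          continuous_on S (\<lambda>(t, x). d_x V (\<lambda>v. v $ i) t x))"

definition derivs_converge :: "(real \<times> real) set \<Rightarrow> (real \<Rightarrow> real \<Rightarrow> state) \<Rightarrow> bool" where
  "derivs_converge S V \<longleftrightarrow>
     (\<forall>i. (\<exists>l. ((\<lambda>(t, x). d_t V (\<lambda>v. v $ i) t x) \<longlongrightarrow> l) (at (0, 0) within S)) \<and>
          (\<exists>l. ((\<lambda>(t, x). d_x V (\<lambda>v. v $ i) t x) \<longlongrightarrow> l) (at (0, 0) within S)))"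

text \<open>Near (0,0), V is the solution of the generalized Riemann problem with piecewise linear
  data in the acoustic case, with characteristic curves X.\<close>

definition acoustic_GRP_solution ::
  "(real \<Rightarrow> real) \<Rightarrow> state \<Rightarrow> state \<Rightarrow> state \<Rightarrow> state \<Rightarrow> real \<Rightarrow> real \<Rightarrow>
     (wave \<Rightarrow> real \<Rightarrow> real) \<Rightarrow> (real \<Rightarrow> real \<Rightarrow> state) \<Rightarrow> bool" where
  "acoustic_GRP_solution W VL VL' VR VR' T r X V \<longleftrightarrow>
     W C1_differentiable_on UNIV \<and>
     VL = VR \<and> VL' \<noteq> VR' \<and> admissible VL \<and> admissible VR \<and>
     0 < T \<and> 0 < r \<and>
     continuous_on ({0..<T} \<times> {-r<..<r}) (\<lambda>(t, x). V t x) \<and>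
     (\<forall>t\<in>{0..<T}. \<forall>x\<in>{-r<..<r}. admissible (V t x)) \<and>
     (\<forall>x\<in>{-r<..<0}. V 0 x = VL + x *\<^sub>R VL') \<and>
     (\<forall>x\<in>{0<..<r}. V 0 x = VR + x *\<^sub>R VR') \<and>
     (\<forall>w. X w 0 = 0 \<and>
          (\<forall>t\<in>{0..<T}. X w t \<in> {-r<..<r} \<and>
             (X w has_real_derivative wave_speed w (V t (X w t))) (at t within {0..<T}))) \<and>
     (\<forall>K. C1_field_on (region_set T r X K) V \<and>
          derivs_converge (region_set T r X K) V \<and>
          (\<forall>(t, x)\<in>region_set T r X K. ten_moment_at W V t x))"

text \<open>A total operator; for the derivatives of a solution the limit exists by derivs_converge.\<close>

definition origin_limit ::
  "real \<Rightarrow> real \<Rightarrow> (wave \<Rightarrow> real \<Rightarrow> real) \<Rightarrow> region \<Rightarrow> (real \<Rightarrow> real \<Rightarrow> real) \<Rightarrow> real" where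
  "origin_limit T r X K f = Lim (at (0, 0) within region_set T r X K) (\<lambda>(t, x). f t x)"

end

theory Submission imports Defs begin

text \<open>
  Two facts about the limits at the origin determine the derivatives in the wave fan. First, the solution is continuous
  across each wave curve, so the two adjacent regions compute the same derivative along it
  (\<open>derivative_along_curve\<close>): across a wave of speed \<open>s\<close> the material derivative jumps by
  \<open>u\<^sub>1 - s\<close> times the jump of the space derivative (\<open>jump_relation\<close>). Second, the differential
  equations pass to the limit in each region, with the same source term (\<open>limit_equations\<close>).
  Together they say that the jump of \<open>\<partial>\<^sub>x V\<close> across a wave is an eigenvector of the
  quasilinear system for its speed.

  The remaining argument is linear algebra. Only the acoustic waves \<open>u\<^sub>1 \<plusminus> c\<close> change the slopes of
  \<open>u\<^sub>1\<close> and \<open>p\<^sub>1\<^sub>1\<close>, so these have common values in the four inner regions, and comparing the material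
  derivative of \<open>u\<^sub>1\<close> computed from the left and from the right data fixes them
  (\<open>p11_rate_from_data\<close>). In an acoustic wave the slope of \<open>u\<^sub>2\<close> follows that of \<open>u\<^sub>1\<close>, which gives the
  values next to the acoustic waves from the data. The shear waves \<open>u\<^sub>1 \<plusminus> c / \<surd>3\<close> each leave one
  combination of the rates of \<open>u\<^sub>2\<close> and \<open>p\<^sub>1\<^sub>2\<close> unchanged, and the contact leaves both unchanged; these
  two relations give the rates next to the contact (\<open>double_star_rates\<close>). The data enter through
  the outermost regions, where the limit of \<open>\<partial>\<^sub>x V\<close> is the slope of the initial line
  (\<open>lim_dx_RegL\<close>, \<open>lim_dx_RegR\<close>).
\<close>

section \<open>Derivatives at a boundary point\<close>

lemma at_within_Ico_at_right:
  fixes a b :: real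
  assumes "a < b"
  shows "at a within {a..<b} = at_right a"
  by (rule at_within_nhd[where S = "{..<b}"]) (use assms in auto)

text \<open>A chord from the origin to a point of the edge may leave \<open>S\<close>. The path used instead runs up a ray of slope \<open>\<sigma>\<close> inside \<open>S\<close> and then
  horizontally to the edge. The mean value theorem on the two pieces gives
  \<open>(A + \<sigma> * B) * t\<close> and \<open>(s - \<sigma>) * B * t\<close> up to \<open>o(t)\<close>, and \<open>\<sigma>\<close> cancels in the sum.\<close>

lemma derivative_along_edge:
  fixes f ft fx :: "real \<Rightarrow> real \<Rightarrow> real"
  assumes cont: "continuous_on \<Omega> (\<lambda>(t, x). f t x)"
    and sub: "S \<subseteq> \<Omega>" and origin: "(0, 0) \<in> \<Omega>"
    and der: "\<And>t x. (t, x) \<in> S \<Longrightarrow>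
      ((\<lambda>(t, x). f t x) has_derivative (\<lambda>(h, k). h * ft t x + k * fx t x)) (at (t, x))"
    and ft: "((\<lambda>(t, x). ft t x) \<longlongrightarrow> A) (at (0, 0) within S)"
    and fx: "((\<lambda>(t, x). fx t x) \<longlongrightarrow> B) (at (0, 0) within S)"
    and ray: "\<forall>\<^sub>F t in at_right 0. (t, \<sigma> * t) \<in> S"
    and strip: "\<forall>\<^sub>F t in at_right 0. \<forall>l\<in>{0<..<1}. (t, \<sigma> * t + l * (e t - \<sigma> * t)) \<in> S"
    and edge: "\<forall>\<^sub>F t in at_right 0. (t, e t) \<in> \<Omega>"
    and slope: "((\<lambda>t. e t / t) \<longlongrightarrow> s) (at_right 0)"
  shows "((\<lambda>t. (f t (e t) - f 0 0) / t) \<longlongrightarrow> A + s * B) (at_right 0)"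
proof -
  from eventually_conj[OF ray eventually_conj[OF strip edge]]
  obtain b where b: "0 < b" and
    near: "\<And>t. 0 < t \<Longrightarrow> t < b \<Longrightarrow> (t, \<sigma> * t) \<in> S \<and> (t, e t) \<in> \<Omega> \<and>
      (\<forall>l\<in>{0<..<1}. (t, \<sigma> * t + l * (e t - \<sigma> * t)) \<in> S)"
    unfolding eventually_at_right_field by blast
  have mean_values: "\<exists>\<tau> l. 0 < \<tau> \<and> \<tau> < t \<and> 0 < l \<and> l < 1 \<and>
      f t (\<sigma> * t) - f 0 0 = t * (ft \<tau> (\<sigma> * \<tau>) + \<sigma> * fx \<tau> (\<sigma> * \<tau>)) \<and>
      f t (e t) - f t (\<sigma> * t) = (e t - \<sigma> * t) * fx t (\<sigma> * t + l * (e t - \<sigma> * t))"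
    if t: "0 < t" "t < b" for t
  proof -
    have ray_cont: "continuous_on {0..t} (\<lambda>\<tau>. (\<lambda>(t, x). f t x) (\<tau>, \<sigma> * \<tau>))"
    proof (rule continuous_on_compose2[OF cont])
      show "(\<lambda>\<tau>. (\<tau>, \<sigma> * \<tau>)) ` {0..t} \<subseteq> \<Omega>"
      proof
        fix z assume "z \<in> (\<lambda>\<tau>. (\<tau>, \<sigma> * \<tau>)) ` {0..t}"
        then obtain \<tau> where "z = (\<tau>, \<sigma> * \<tau>)" "0 \<le> \<tau>" "\<tau> \<le> t" by auto
        then show "z \<in> \<Omega>" using near[of \<tau>] sub origin t by (cases "\<tau> = 0") auto
      qed
    qed (intro continuous_intros)
    have ray_der: "((\<lambda>\<tau>. (\<lambda>(t, x). f t x) (\<tau>, \<sigma> * \<tau>)) has_derivative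
        (\<lambda>h. h * ft \<tau> (\<sigma> * \<tau>) + \<sigma> * h * fx \<tau> (\<sigma> * \<tau>))) (at \<tau>)"
      if "0 < \<tau>" "\<tau> < t" for \<tau>
    proof -
      have inside: "(\<tau>, \<sigma> * \<tau>) \<in> S" using near[of \<tau>] that t by simp
      have path: "((\<lambda>\<tau>. (\<tau>, \<sigma> * \<tau>)) has_derivative (\<lambda>h. (h, \<sigma> * h))) (at \<tau>)"
        by (auto intro!: derivative_eq_intros)
      show ?thesis using has_derivative_compose[OF path, OF der[OF inside]] by (simp add: mult.assoc)
    qed
    obtain \<tau> where \<tau>: "0 < \<tau>" "\<tau> < t"
      and ray_mean: "(\<lambda>(t, x). f t x) (t, \<sigma> * t) - (\<lambda>(t, x). f t x) (0, \<sigma> * 0) =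
        (t - 0) * ft \<tau> (\<sigma> * \<tau>) + \<sigma> * (t - 0) * fx \<tau> (\<sigma> * \<tau>)"
      by (rule mvt[OF t(1) ray_cont ray_der])
    have ray_mean: "f t (\<sigma> * t) - f 0 0 = t * (ft \<tau> (\<sigma> * \<tau>) + \<sigma> * fx \<tau> (\<sigma> * \<tau>))"
      using ray_mean by (simp add: distrib_left)
    let ?p = "\<lambda>l. (t, \<sigma> * t + l * (e t - \<sigma> * t))"
    have strip_cont: "continuous_on {0..1} (\<lambda>l. (\<lambda>(t, x). f t x) (?p l))"
    proof (rule continuous_on_compose2[OF cont])
      show "?p ` {0..1} \<subseteq> \<Omega>"
      proof
        fix z assume "z \<in> ?p ` {0..1}"
        then obtain l where "z = ?p l" "0 \<le> l" "l \<le> 1" by (metis (no_types, lifting) atLeastAtMost_iff imageE)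
        then consider "z = (t, \<sigma> * t)" | "z = (t, e t)" | "z = ?p l" "0 < l" "l < 1"
          by (cases "l = 0"; cases "l = 1") auto
        then show "z \<in> \<Omega>" using near[OF t] sub by cases auto
      qed
    qed (intro continuous_intros)
    have strip_der: "((\<lambda>l. (\<lambda>(t, x). f t x) (?p l)) has_derivative
        (\<lambda>h. h * (e t - \<sigma> * t) * fx t (\<sigma> * t + l * (e t - \<sigma> * t)))) (at l)"
      if "0 < l" "l < 1" for l
    proof -
      have inside: "?p l \<in> S" using near[OF t] that by simp
      have path: "(?p has_derivative (\<lambda>h. (0, h * (e t - \<sigma> * t)))) (at l)"
        by (auto intro!: derivative_eq_intros)
      show ?thesis using has_derivative_compose[OF path, OF der[OF inside]] by (simp add: mult.assoc)
    qed
    obtain l where l: "0 < l" "l < 1"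
      and strip_mean: "(\<lambda>(t, x). f t x) (?p 1) - (\<lambda>(t, x). f t x) (?p 0) =
        (1 - 0) * (e t - \<sigma> * t) * fx t (\<sigma> * t + l * (e t - \<sigma> * t))"
      by (rule mvt[OF zero_less_one strip_cont strip_der])
    have strip_mean: "f t (e t) - f t (\<sigma> * t) = (e t - \<sigma> * t) * fx t (\<sigma> * t + l * (e t - \<sigma> * t))"
      using strip_mean by simp
    from \<tau> ray_mean l strip_mean show ?thesis by blast
  qed
  \<comment> \<open>The intermediate points become functions of \<open>t\<close>, so that the limits can be taken by composition.\<close>
  then obtain \<tau> l where \<tau>: "\<And>t. 0 < t \<Longrightarrow> t < b \<Longrightarrow> 0 < \<tau> t \<and> \<tau> t < t \<and>
        f t (\<sigma> * t) - f 0 0 = t * (ft (\<tau> t) (\<sigma> * \<tau> t) + \<sigma> * fx (\<tau> t) (\<sigma> * \<tau> t))"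
    and l: "\<And>t. 0 < t \<Longrightarrow> t < b \<Longrightarrow> 0 < l t \<and> l t < 1 \<and>
        f t (e t) - f t (\<sigma> * t) = (e t - \<sigma> * t) * fx t (\<sigma> * t + l t * (e t - \<sigma> * t))"
    by metis
  have small: "\<forall>\<^sub>F t in at_right 0. 0 < t \<and> t < b"
    using b unfolding eventually_at_right_field by blast
  have id0: "((\<lambda>t::real. t) \<longlongrightarrow> 0) (at_right 0)" by (rule tendsto_ident_at)
  have \<tau>0: "(\<tau> \<longlongrightarrow> 0) (at_right 0)"
    by (rule tendsto_sandwich[OF _ _ tendsto_const id0])
      (use small in \<open>eventually_elim, use \<tau> in force\<close>)+
  let ?q = "\<lambda>t. (\<tau> t, \<sigma> * \<tau> t)"
  let ?p = "\<lambda>t. (t, \<sigma> * t + l t * (e t - \<sigma> * t))"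
  have "filterlim ?q (at (0, 0) within S) (at_right 0)"
    unfolding filterlim_at
  proof
    show "\<forall>\<^sub>F t in at_right 0. ?q t \<in> S \<and> ?q t \<noteq> (0, 0)"
      using small
    proof eventually_elim
      case (elim t)
      then show ?case using \<tau>[of t] near[of "\<tau> t"] by auto
    qed
    show "(?q \<longlongrightarrow> (0, 0)) (at_right 0)"
      using tendsto_Pair[OF \<tau>0 tendsto_mult[OF tendsto_const[of \<sigma>] \<tau>0]] by simp
  qed
  then have ray_lim: "((\<lambda>t. ft (\<tau> t) (\<sigma> * \<tau> t)) \<longlongrightarrow> A) (at_right 0)"
    "((\<lambda>t. fx (\<tau> t) (\<sigma> * \<tau> t)) \<longlongrightarrow> B) (at_right 0)"
    using filterlim_compose[OF ft] filterlim_compose[OF fx] by fastforce+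
  have e0: "(e \<longlongrightarrow> 0) (at_right 0)"
  proof -
    have "((\<lambda>t. e t / t * t) \<longlongrightarrow> s * 0) (at_right 0)"
      by (intro tendsto_mult slope id0)
    moreover have "\<forall>\<^sub>F t in at_right 0. e t / t * t = e t"
      using small by eventually_elim simp
    ultimately show ?thesis using tendsto_cong by fastforce
  qed
  have "filterlim ?p (at (0, 0) within S) (at_right 0)"
    unfolding filterlim_at
  proof
    show "\<forall>\<^sub>F t in at_right 0. ?p t \<in> S \<and> ?p t \<noteq> (0, 0)"
      using small by eventually_elim (use l near in force)
    have d0: "((\<lambda>t. \<sigma> * t) \<longlongrightarrow> 0) (at_right 0)" "((\<lambda>t. e t - \<sigma> * t) \<longlongrightarrow> 0) (at_right 0)"
      using tendsto_mult[OF tendsto_const[of \<sigma>] id0] tendsto_diff[OF e0 tendsto_mult[OF tendsto_const[of \<sigma>] id0]]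
      by simp_all
    have "((\<lambda>t. l t * (e t - \<sigma> * t)) \<longlongrightarrow> 0) (at_right 0)"
    proof (rule Lim_null_comparison[OF _ tendsto_norm_zero[OF d0(2)]])
      show "\<forall>\<^sub>F t in at_right 0. norm (l t * (e t - \<sigma> * t)) \<le> norm (e t - \<sigma> * t)"
        using small
      proof eventually_elim
        case (elim t)
        then have "\<bar>l t\<bar> \<le> 1" using l[of t] by auto
        then show ?case by (simp add: abs_mult mult_left_le_one_le)
      qed
    qed
    then show "(?p \<longlongrightarrow> (0, 0)) (at_right 0)"
      using tendsto_Pair[OF id0 tendsto_add[OF d0(1)]] by force
  qed
  then have strip_lim: "((\<lambda>t. fx t (\<sigma> * t + l t * (e t - \<sigma> * t))) \<longlongrightarrow> B) (at_right 0)"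
    using filterlim_compose[OF fx] by fastforce
  have "((\<lambda>t. (ft (\<tau> t) (\<sigma> * \<tau> t) + \<sigma> * fx (\<tau> t) (\<sigma> * \<tau> t)) +
      (e t / t - \<sigma>) * fx t (\<sigma> * t + l t * (e t - \<sigma> * t))) \<longlongrightarrow> (A + \<sigma> * B) + (s - \<sigma>) * B) (at_right 0)"
    by (intro tendsto_intros ray_lim strip_lim slope)
  moreover have "\<forall>\<^sub>F t in at_right 0. (ft (\<tau> t) (\<sigma> * \<tau> t) + \<sigma> * fx (\<tau> t) (\<sigma> * \<tau> t)) +
      (e t / t - \<sigma>) * fx t (\<sigma> * t + l t * (e t - \<sigma> * t)) = (f t (e t) - f 0 0) / t"
    using small
  proof eventually_elim
    case (elim t)
    then have "f t (e t) - f 0 0 = (e t - \<sigma> * t) * fx t (\<sigma> * t + l t * (e t - \<sigma> * t))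
        + t * (ft (\<tau> t) (\<sigma> * \<tau> t) + \<sigma> * fx (\<tau> t) (\<sigma> * \<tau> t))"
      using \<tau>[of t] l[of t] by linarith
    moreover have "e t / t - \<sigma> = (e t - \<sigma> * t) / t" using elim by (simp add: field_simps)
    ultimately show ?case using elim by (simp add: add_divide_distrib)
  qed
  ultimately have "((\<lambda>t. (f t (e t) - f 0 0) / t) \<longlongrightarrow> (A + \<sigma> * B) + (s - \<sigma>) * B) (at_right 0)"
    using tendsto_cong by fastforce
  then show ?thesis by (simp add: algebra_simps)
qed

text \<open>The derivative \<open>fx\<close> lives only at positive times. A difference quotient between two nearby points of
  \<open>J\<close> at a small positive time lies within \<open>\<epsilon>\<close> of \<open>B\<close>; letting the time tend to zero turns it into the
  slope \<open>b\<close> of the data.\<close>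

lemma space_derivative_limit_from_data:
  fixes f fx :: "real \<Rightarrow> real \<Rightarrow> real"
  assumes cont: "\<And>x. x \<in> J \<Longrightarrow> ((\<lambda>t. f t x) \<longlongrightarrow> f 0 x) (at_right 0)"
    and data: "\<And>x. x \<in> J \<Longrightarrow> f 0 x = a + b * x"
    and J: "0 islimpt J"
    and rows: "\<And>x y. x \<in> J \<Longrightarrow> y \<in> J \<Longrightarrow> x < y \<Longrightarrow>
      \<forall>\<^sub>F t in at_right 0. \<forall>z\<in>{x..y}. (t, z) \<in> S"
    and der: "\<And>t x. (t, x) \<in> S \<Longrightarrow> (f t has_real_derivative fx t x) (at x)"
    and fx: "((\<lambda>(t, x). fx t x) \<longlongrightarrow> B) (at (0, 0) within S)"
  shows "B = b"
proof (rule ccontr)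
  assume "B \<noteq> b"
  define \<epsilon> where "\<epsilon> = \<bar>B - b\<bar> / 2"
  have \<epsilon>: "0 < \<epsilon>" using \<open>B \<noteq> b\<close> by (simp add: \<epsilon>_def)
  obtain \<delta> where \<delta>: "0 < \<delta>" and
    close: "\<And>t x. (t, x) \<in> S \<Longrightarrow> (t, x) \<noteq> (0, 0) \<Longrightarrow> dist (t, x) (0, 0) < \<delta> \<Longrightarrow> \<bar>fx t x - B\<bar> < \<epsilon>"
    using fx \<epsilon> unfolding Lim_within dist_real_def by (metis case_prod_conv dist_nz)
  have "\<exists>x\<in>J. \<exists>y\<in>J. x < y \<and> \<bar>x\<bar> < \<delta> / 2 \<and> \<bar>y\<bar> < \<delta> / 2"
  proof -
    obtain x where x: "x \<in> J" "x \<noteq> 0" "\<bar>x\<bar> < \<delta> / 2"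
      using J \<delta> unfolding islimpt_approachable dist_real_def
      by (metis diff_zero half_gt_zero)
    \<comment> \<open>A second point even closer to the origin, hence different from \<open>x\<close>.\<close>
    obtain y where y: "y \<in> J" "\<bar>y\<bar> < \<bar>x\<bar>"
      using J x unfolding islimpt_approachable dist_real_def
      by (metis diff_zero zero_less_abs_iff)
    show ?thesis using x y by (cases x y rule: linorder_cases) force+
  qed
  then obtain x y where xy: "x \<in> J" "y \<in> J" "x < y" "\<bar>x\<bar> < \<delta> / 2" "\<bar>y\<bar> < \<delta> / 2" by blast
  have "\<forall>\<^sub>F t in at_right (0::real). 0 < t \<and> t < \<delta> / 2"
    using \<delta> unfolding eventually_at_right_field by (metis half_gt_zero)
  with rows[OF xy(1-3)]
  have "\<forall>\<^sub>F t in at_right 0. \<bar>(f t y - f t x) - B * (y - x)\<bar> \<le> \<epsilon> * (y - x)"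
  proof eventually_elim
    case (elim t)
    obtain z where z: "x < z" "z < y" "f t y - f t x = (y - x) * fx t z"
      using MVT2[OF xy(3), of "f t" "fx t"] der elim by force
    have "norm (t, z) \<le> norm t + norm z" by (rule norm_Pair_le)
    also have "\<dots> < \<delta>" using z xy elim by auto
    finally have "dist (t, z) (0, 0) < \<delta>" by (simp add: dist_norm)
    then have "\<bar>fx t z - B\<bar> < \<epsilon>" using close[of t z] z elim by simp
    moreover have "(f t y - f t x) - B * (y - x) = (fx t z - B) * (y - x)"
      using z by (simp add: algebra_simps)
    ultimately show ?case using xy(3) by (simp add: abs_mult mult_right_mono)
  qed
  moreover have "((\<lambda>t. \<bar>(f t y - f t x) - B * (y - x)\<bar>) \<longlongrightarrow> \<bar>(f 0 y - f 0 x) - B * (y - x)\<bar>) (at_right 0)"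
    by (intro tendsto_intros cont xy)
  ultimately have "\<bar>(f 0 y - f 0 x) - B * (y - x)\<bar> \<le> \<epsilon> * (y - x)"
    using tendsto_upperbound[OF _ _ trivial_limit_at_right_real] by fast
  also have "(f 0 y - f 0 x) - B * (y - x) = (b - B) * (y - x)"
    using data xy by (simp add: algebra_simps)
  finally have "\<bar>b - B\<bar> \<le> \<epsilon>" using xy(3) by (simp add: abs_mult)
  then show False using \<epsilon> unfolding \<epsilon>_def by (simp add: abs_minus_commute)
qed

lemma component_has_derivative:
  assumes "(\<lambda>(t, x). V t x) differentiable (at (t, x))"
  shows "((\<lambda>(t, x). V t x $ i) has_derivative
    (\<lambda>(h, k). h * d_t V (\<lambda>v. v $ i) t x + k * d_x V (\<lambda>v. v $ i) t x)) (at (t, x))"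
proof -
  obtain D where D: "((\<lambda>(t, x). V t x) has_derivative D) (at (t, x))"
    using assms unfolding differentiable_def by blast
  then have "((\<lambda>z. (case z of (t, x) \<Rightarrow> V t x) $ i) has_derivative (\<lambda>z. D z $ i)) (at (t, x))"
    by (rule bounded_linear.has_derivative[OF bounded_linear_vec_nth])
  then have Di: "((\<lambda>(t, x). V t x $ i) has_derivative (\<lambda>z. D z $ i)) (at (t, x))"
    by (simp add: case_prod_unfold)
  define a b where "a = D (1, 0) $ i" and "b = D (0, 1) $ i"
  have lin: "D (h, k) $ i = h * a + k * b" for h k
  proof -
    have "D (h, k) = D (h *\<^sub>R (1, 0) + k *\<^sub>R (0, 1))" by simp
    also have "\<dots> = h *\<^sub>R D (1, 0) + k *\<^sub>R D (0, 1)"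
      using has_derivative_linear[OF D] by (simp only: linear_add linear_scale)
    finally show ?thesis by (simp add: a_def b_def)
  qed
  have "((\<lambda>s. (s, x)) has_derivative (\<lambda>h. (h, 0))) (at t)"
    by (auto intro!: derivative_eq_intros)
  from has_derivative_compose[OF this, of "\<lambda>(t, x). V t x $ i", OF Di, unfolded prod.case]
  have "((\<lambda>s. V s x $ i) has_real_derivative a) (at t)"
    by (rule has_derivative_imp_has_field_derivative) (simp add: lin)
  then have t: "d_t V (\<lambda>v. v $ i) t x = a"
    unfolding d_t_def by (rule DERIV_imp_deriv)
  have "((\<lambda>y. (t, y)) has_derivative (\<lambda>k. (0, k))) (at x)"
    by (auto intro!: derivative_eq_intros)
  from has_derivative_compose[OF this, of "\<lambda>(t, x). V t x $ i", OF Di, unfolded prod.case]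
  have "((\<lambda>y. V t y $ i) has_real_derivative b) (at x)"
    by (rule has_derivative_imp_has_field_derivative) (simp add: lin)
  then have x: "d_x V (\<lambda>v. v $ i) t x = b"
    unfolding d_x_def by (rule DERIV_imp_deriv)
  have "(\<lambda>z. D z $ i) = (\<lambda>(h, k). h * d_t V (\<lambda>v. v $ i) t x + k * d_x V (\<lambda>v. v $ i) t x)"
    using lin by (auto simp: t x)
  with Di show ?thesis by simp
qed

section \<open>Geometry of the wave fan\<close>

primrec lower_edge :: "real \<Rightarrow> (wave \<Rightarrow> real \<Rightarrow> real) \<Rightarrow> region \<Rightarrow> real \<Rightarrow> real" where
  "lower_edge r X RegL t = - r"
| "lower_edge r X StarL t = X Wave1 t"
| "lower_edge r X StarStarL t = X Wave2 t"
| "lower_edge r X StarStarR t = X Contact t"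
| "lower_edge r X StarR t = X Wave5 t"
| "lower_edge r X RegR t = X Wave6 t"

primrec upper_edge :: "real \<Rightarrow> (wave \<Rightarrow> real \<Rightarrow> real) \<Rightarrow> region \<Rightarrow> real \<Rightarrow> real" where
  "upper_edge r X RegL t = X Wave1 t"
| "upper_edge r X StarL t = X Wave2 t"
| "upper_edge r X StarStarL t = X Contact t"
| "upper_edge r X StarStarR t = X Wave5 t"
| "upper_edge r X StarR t = X Wave6 t"
| "upper_edge r X RegR t = r"

lemma region_set_eq_edges:
  "region_set T r X K = {(t, x). 0 < t \<and> t < T \<and> lower_edge r X K t < x \<and> x < upper_edge r X K t}"
  by (cases K) auto

primrec left_region :: "wave \<Rightarrow> region" where
  "left_region Wave1 = RegL"
| "left_region Wave2 = StarL"
| "left_region Contact = StarStarL"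
| "left_region Wave5 = StarStarR"
| "left_region Wave6 = StarR"

primrec right_region :: "wave \<Rightarrow> region" where
  "right_region Wave1 = StarL"
| "right_region Wave2 = StarStarL"
| "right_region Contact = StarStarR"
| "right_region Wave5 = StarR"
| "right_region Wave6 = RegR"

lemma upper_edge_left_region: "upper_edge r X (left_region w) t = X w t"
  by (cases w) auto

lemma lower_edge_right_region: "lower_edge r X (right_region w) t = X w t"
  by (cases w) auto

text \<open>For small times the ray with this slope lies between the two edges of the region. In the outer
  regions, whose second edge is vertical at a positive distance, any slope beyond the outermost
  wave speed does.\<close>

primrec inner_speed :: "region \<Rightarrow> state \<Rightarrow> real" where
  "inner_speed RegL v = wave_speed Wave1 v - 1"
| "inner_speed StarL v = (wave_speed Wave1 v + wave_speed Wave2 v) / 2"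
| "inner_speed StarStarL v = (wave_speed Wave2 v + wave_speed Contact v) / 2"
| "inner_speed StarStarR v = (wave_speed Contact v + wave_speed Wave5 v) / 2"
| "inner_speed StarR v = (wave_speed Wave5 v + wave_speed Wave6 v) / 2"
| "inner_speed RegR v = wave_speed Wave6 v + 1"

section \<open>Limits at the origin and jumps across the waves\<close>

locale acoustic_GRP =
  fixes W :: "real \<Rightarrow> real" and VL VL' VR VR' :: state and T r :: real
    and X :: "wave \<Rightarrow> real \<Rightarrow> real" and V :: "real \<Rightarrow> real \<Rightarrow> state"
  assumes solution: "acoustic_GRP_solution W VL VL' VR VR' T r X V"
begin

abbreviation region :: "region \<Rightarrow> (real \<times> real) set" where
  "region \<equiv> region_set T r X"

abbreviation at_origin :: "region \<Rightarrow> (real \<times> real) filter" where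
  "at_origin K \<equiv> at (0, 0) within region K"

definition \<Omega> :: "(real \<times> real) set" where "\<Omega> = {0..<T} \<times> {-r<..<r}"

abbreviation c :: real where "c \<equiv> sound_speed VL"

lemma sizes: "0 < T" "0 < r"
  using solution unfolding acoustic_GRP_solution_def by auto

lemma states: "VR = VL" "rho VL > 0" "p11 VL > 0"
  using solution unfolding acoustic_GRP_solution_def admissible_def by auto

lemma sound_speed_pos: "0 < c"
  using states by (simp add: sound_speed_def)

lemma wave_speeds_increasing:
  "wave_speed Wave1 VL < wave_speed Wave2 VL" "wave_speed Wave2 VL < wave_speed Contact VL"
  "wave_speed Contact VL < wave_speed Wave5 VL" "wave_speed Wave5 VL < wave_speed Wave6 VL"
proof -
  have "c / sqrt 3 < c / 1" using sound_speed_pos by (intro divide_strict_left_mono) auto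
  then show "wave_speed Wave1 VL < wave_speed Wave2 VL" "wave_speed Wave5 VL < wave_speed Wave6 VL"
    by simp_all
  show "wave_speed Wave2 VL < wave_speed Contact VL" "wave_speed Contact VL < wave_speed Wave5 VL"
    using sound_speed_pos by simp_all
qed

lemma origin_in_domain: "(0, 0) \<in> \<Omega>"
  using sizes by (simp add: \<Omega>_def)

lemma curve_in_domain: "0 \<le> t \<Longrightarrow> t < T \<Longrightarrow> (t, X w t) \<in> \<Omega>"
  using solution unfolding acoustic_GRP_solution_def \<Omega>_def by auto

lemma region_in_domain: "region K \<subseteq> \<Omega>"
proof -
  have "- r < X w t" "X w t < r" if "0 < t" "t < T" for w t
    using curve_in_domain[of t w] that by (auto simp: \<Omega>_def)
  then have "- r \<le> lower_edge r X K t" "upper_edge r X K t \<le> r" if "0 < t" "t < T" for t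
    using that sizes by (cases K; auto intro!: less_imp_le)+
  then have "- r < x \<and> x < r"
    if "0 < t" "t < T" "lower_edge r X K t < x" "x < upper_edge r X K t" for t x
    using that by (meson le_less_trans less_le_trans)
  then show ?thesis unfolding region_set_eq_edges \<Omega>_def by auto
qed

lemma continuous: "continuous_on \<Omega> (\<lambda>(t, x). V t x)"
  using solution unfolding acoustic_GRP_solution_def \<Omega>_def by blast

lemma data_left: "- r < x \<Longrightarrow> x < 0 \<Longrightarrow> V 0 x = VL + x *\<^sub>R VL'"
  and data_right: "0 < x \<Longrightarrow> x < r \<Longrightarrow> V 0 x = VR + x *\<^sub>R VR'"
  using solution unfolding acoustic_GRP_solution_def by auto

lemma value_at_origin: "V 0 0 = VL"
proof -
  have "continuous_on {-r/2..0} (\<lambda>x. (\<lambda>(t, x). V t x) (0, x))"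
    using sizes by (intro continuous_on_compose2[OF continuous] continuous_intros) (auto simp: \<Omega>_def)
  then have "((\<lambda>x. V 0 x) \<longlongrightarrow> V 0 0) (at 0 within {-r/2..0})"
    using sizes by (simp add: continuous_on_def)
  then have V0: "((\<lambda>x. V 0 x) \<longlongrightarrow> V 0 0) (at_left 0)"
    using at_within_Icc_at_left[of "-r/2" 0] sizes by simp
  have "((\<lambda>x. VL + x *\<^sub>R VL') \<longlongrightarrow> VL + 0 *\<^sub>R VL') (at_left 0)"
    by (intro tendsto_intros)
  moreover have "\<forall>\<^sub>F x in at_left 0. VL + x *\<^sub>R VL' = V 0 x"
    using data_left sizes unfolding eventually_at_left_field
    by (intro exI[of _ "- r"]; force)
  ultimately have "((\<lambda>x. V 0 x) \<longlongrightarrow> VL) (at_left 0)"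
    using Lim_transform_eventually by fastforce
  with V0 show ?thesis
    by (rule tendsto_unique[OF trivial_limit_at_left_real])
qed

lemma state_tendsto: "((\<lambda>(t, x). V t x $ i) \<longlongrightarrow> VL $ i) (at_origin K)"
proof -
  have "((\<lambda>(t, x). V t x) \<longlongrightarrow> V 0 0) (at (0, 0) within \<Omega>)"
    using continuous origin_in_domain unfolding continuous_on_def by force
  then have "((\<lambda>(t, x). V t x) \<longlongrightarrow> V 0 0) (at_origin K)"
    by (rule tendsto_within_subset[OF _ region_in_domain])
  from tendsto_vec_nth[OF this] show ?thesis
    by (simp add: case_prod_unfold value_at_origin)
qed

lemma positive_times: "\<forall>\<^sub>F t in at_right 0. 0 < t \<and> t < T"
  using sizes unfolding eventually_at_right_field by blast

lemma curve_slope: "((\<lambda>t. X w t / t) \<longlongrightarrow> wave_speed w VL) (at_right 0)"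
proof -
  have "X w 0 = 0 \<and> (\<forall>t\<in>{0..<T}. X w t \<in> {-r<..<r} \<and>
      (X w has_real_derivative wave_speed w (V t (X w t))) (at t within {0..<T}))"
    using solution unfolding acoustic_GRP_solution_def by blast
  then have "(X w has_real_derivative wave_speed w VL) (at 0 within {0..<T})" "X w 0 = 0"
    using sizes by (auto simp: value_at_origin dest!: bspec[of _ _ 0])
  then have "((\<lambda>t. X w t / t) \<longlongrightarrow> wave_speed w VL) (at 0 within {0..<T})"
    by (simp add: has_field_derivative_iff)
  then show ?thesis using at_within_Ico_at_right[of 0 T] sizes by simp
qed

lemma ray_below_curve:
  assumes "\<sigma> < wave_speed w VL" shows "\<forall>\<^sub>F t in at_right 0. \<sigma> * t < X w t"
  using order_tendstoD(1)[OF curve_slope assms] positive_times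
  by eventually_elim (simp add: field_simps)

lemma ray_above_curve:
  assumes "wave_speed w VL < \<sigma>" shows "\<forall>\<^sub>F t in at_right 0. X w t < \<sigma> * t"
  using order_tendstoD(2)[OF curve_slope assms] positive_times
  by eventually_elim (simp add: field_simps)

lemma ray_in_strip: "\<forall>\<^sub>F t in at_right 0. - r < \<sigma> * t" "\<forall>\<^sub>F t in at_right 0. \<sigma> * t < r"
proof -
  have "((\<lambda>t. \<sigma> * t) \<longlongrightarrow> \<sigma> * 0) (at_right 0)" by (intro tendsto_intros)
  then show "\<forall>\<^sub>F t in at_right 0. - r < \<sigma> * t" "\<forall>\<^sub>F t in at_right 0. \<sigma> * t < r"
    using order_tendstoD[of "\<lambda>t. \<sigma> * t" "\<sigma> * 0" "at_right 0"] sizes by auto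
qed

lemma ray_between_edges:
  "\<forall>\<^sub>F t in at_right 0. 0 < t \<and> t < T \<and>
     lower_edge r X K t < inner_speed K VL * t \<and> inner_speed K VL * t < upper_edge r X K t"
proof -
  have "\<forall>\<^sub>F t in at_right 0. lower_edge r X K t < inner_speed K VL * t"
    by (cases K; simp only: lower_edge.simps inner_speed.simps; intro ray_above_curve ray_in_strip)
      (insert wave_speeds_increasing, simp_all del: wave_speed.simps add: field_simps)
  moreover have "\<forall>\<^sub>F t in at_right 0. inner_speed K VL * t < upper_edge r X K t"
    by (cases K; simp only: upper_edge.simps inner_speed.simps; intro ray_below_curve ray_in_strip)
      (insert wave_speeds_increasing, simp_all del: wave_speed.simps add: field_simps)
  ultimately show ?thesis using positive_times by eventually_elim simp
qed

lemma ray_in_region: "\<forall>\<^sub>F t in at_right 0. (t, inner_speed K VL * t) \<in> region K"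
  using ray_between_edges[of K] by eventually_elim (simp add: region_set_eq_edges)

text \<open>The inner ray accumulates at the origin, so a limit taken from inside the region is unique.\<close>

lemma at_origin_nontrivial: "at_origin K \<noteq> bot"
proof
  assume "at_origin K = bot"
  moreover have "filterlim (\<lambda>t. (t, inner_speed K VL * t)) (at_origin K) (at_right 0)"
    unfolding filterlim_at
  proof
    show "\<forall>\<^sub>F t in at_right 0. (t, inner_speed K VL * t) \<in> region K \<and>
        (t, inner_speed K VL * t) \<noteq> (0, 0)"
      using ray_in_region[of K] positive_times by eventually_elim auto
    have "((\<lambda>t. (t, inner_speed K VL * t)) \<longlongrightarrow> (0, inner_speed K VL * 0)) (at_right 0)"
      by (intro tendsto_intros)
    then show "((\<lambda>t. (t, inner_speed K VL * t)) \<longlongrightarrow> (0, 0)) (at_right 0)" by simp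
  qed
  ultimately show False
    using trivial_limit_at_right_real[of 0] by (simp add: filterlim_def bot_unique filtermap_bot_iff)
qed

lemma origin_limit_eqI:
  "((\<lambda>(t, x). f t x) \<longlongrightarrow> l) (at_origin K) \<Longrightarrow> origin_limit T r X K f = l"
  unfolding origin_limit_def by (rule tendsto_Lim[OF at_origin_nontrivial])

definition lim_dt :: "region \<Rightarrow> 6 \<Rightarrow> real" where
  "lim_dt K i = origin_limit T r X K (d_t V (\<lambda>v. v $ i))"

definition lim_dx :: "region \<Rightarrow> 6 \<Rightarrow> real" where
  "lim_dx K i = origin_limit T r X K (d_x V (\<lambda>v. v $ i))"

definition lim_D :: "region \<Rightarrow> 6 \<Rightarrow> real" where
  "lim_D K i = origin_limit T r X K (material V (\<lambda>v. v $ i))"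

lemma derivative_limits:
  "((\<lambda>(t, x). d_t V (\<lambda>v. v $ i) t x) \<longlongrightarrow> lim_dt K i) (at_origin K)"
  "((\<lambda>(t, x). d_x V (\<lambda>v. v $ i) t x) \<longlongrightarrow> lim_dx K i) (at_origin K)"
proof -
  have "derivs_converge (region K) V"
    using solution unfolding acoustic_GRP_solution_def by blast
  then show "((\<lambda>(t, x). d_t V (\<lambda>v. v $ i) t x) \<longlongrightarrow> lim_dt K i) (at_origin K)"
    "((\<lambda>(t, x). d_x V (\<lambda>v. v $ i) t x) \<longlongrightarrow> lim_dx K i) (at_origin K)"
    unfolding derivs_converge_def lim_dt_def lim_dx_def using origin_limit_eqI by metis+
qed

lemma material_limit:
  "((\<lambda>(t, x). material V (\<lambda>v. v $ i) t x) \<longlongrightarrow> lim_dt K i + u1 VL * lim_dx K i) (at_origin K)"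
  using tendsto_add[OF derivative_limits(1)[of i K]
      tendsto_mult[OF state_tendsto derivative_limits(2)[of i K]]]
  unfolding material_def by (simp add: case_prod_unfold)

lemma lim_D_eq: "lim_D K i = lim_dt K i + u1 VL * lim_dx K i"
  unfolding lim_D_def by (rule origin_limit_eqI[OF material_limit])

lemma lim_D_limit: "((\<lambda>(t, x). material V (\<lambda>v. v $ i) t x) \<longlongrightarrow> lim_D K i) (at_origin K)"
  using material_limit by (simp add: lim_D_eq)

lemma component_derivative:
  assumes "(t, x) \<in> region K"
  shows "((\<lambda>(t, x). V t x $ i) has_derivative
    (\<lambda>(h, k). h * d_t V (\<lambda>v. v $ i) t x + k * d_x V (\<lambda>v. v $ i) t x)) (at (t, x))"
proof (rule component_has_derivative)
  have "C1_field_on (region K) V"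
    using solution unfolding acoustic_GRP_solution_def by blast
  then show "(\<lambda>(t, x). V t x) differentiable (at (t, x))"
    using assms unfolding C1_field_on_def by blast
qed

lemma continuous_component: "continuous_on \<Omega> (\<lambda>(t, x). V t x $ i)"
  using continuous_on_component[OF continuous] by (simp add: case_prod_unfold)

lemma strip_towards_edge:
  assumes "\<And>t. e t = lower_edge r X K t \<or> e t = upper_edge r X K t"
  shows "\<forall>\<^sub>F t in at_right 0. \<forall>l\<in>{0<..<1}.
    (t, inner_speed K VL * t + l * (e t - inner_speed K VL * t)) \<in> region K"
  using ray_between_edges[of K]
proof eventually_elim
  case (elim t)
  show ?case
  proof
    fix l :: real assume l: "l \<in> {0<..<1}"
    let ?m = "inner_speed K VL * t"
    have convex_comb: "?m + l * (e t - ?m) = (1 - l) * ?m + l * e t"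
      by (simp add: algebra_simps)
    have "lower_edge r X K t = (1 - l) * lower_edge r X K t + l * lower_edge r X K t"
      by (simp add: algebra_simps)
    also have "\<dots> < (1 - l) * ?m + l * e t"
      using elim l assms[of t] by (intro add_less_le_mono mult_strict_left_mono mult_left_mono) auto
    finally have "lower_edge r X K t < ?m + l * (e t - ?m)" by (simp only: convex_comb)
    moreover have "(1 - l) * ?m + l * e t
        < (1 - l) * upper_edge r X K t + l * upper_edge r X K t"
      using elim l assms[of t] by (intro add_less_le_mono mult_strict_left_mono mult_left_mono) auto
    then have "?m + l * (e t - ?m) < upper_edge r X K t"
      by (simp only: convex_comb) (simp add: algebra_simps)
    ultimately show "(t, ?m + l * (e t - ?m)) \<in> region K"
      using elim by (simp add: region_set_eq_edges)
  qed
qed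

text \<open>The tangential derivative at the origin is determined by the values of the field on the curve,
  but its expression is the one computed from inside the adjacent region.\<close>

lemma derivative_along_curve:
  assumes "K = left_region w \<or> K = right_region w"
  shows "((\<lambda>t. (V t (X w t) $ i - V 0 0 $ i) / t)
    \<longlongrightarrow> lim_dt K i + wave_speed w VL * lim_dx K i) (at_right 0)"
proof (rule derivative_along_edge[where f = "\<lambda>t x. V t x $ i",
      OF continuous_component region_in_domain origin_in_domain component_derivative
         derivative_limits ray_in_region _ _ curve_slope])
  show "\<forall>\<^sub>F t in at_right 0. \<forall>l\<in>{0<..<1}.
      (t, inner_speed K VL * t + l * (X w t - inner_speed K VL * t)) \<in> region K"
    using assms upper_edge_left_region lower_edge_right_region
    by (intro strip_towards_edge) metis
  show "\<forall>\<^sub>F t in at_right 0. (t, X w t) \<in> \<Omega>"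
    using positive_times by eventually_elim (simp add: curve_in_domain)
qed

text \<open>Both neighbours of a wave compute the derivative of the same function along the common curve.
  Hence the limits of \<open>\<partial>\<^sub>t + s \<partial>\<^sub>x\<close> agree, and the material derivative jumps by
  \<open>u\<^sub>1 - s\<close> times the jump of the space derivative.\<close>

lemma jump_relation:
  "lim_D (right_region w) i - lim_D (left_region w) i =
    (u1 VL - wave_speed w VL) * (lim_dx (right_region w) i - lim_dx (left_region w) i)"
proof -
  have "lim_dt (right_region w) i + wave_speed w VL * lim_dx (right_region w) i =
      lim_dt (left_region w) i + wave_speed w VL * lim_dx (left_region w) i"
    by (rule tendsto_unique[OF trivial_limit_at_right_real
          derivative_along_curve derivative_along_curve]) auto
  then show ?thesis by (simp add: lim_D_eq algebra_simps)
qed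

lemma component_space_derivative:
  assumes "(t, x) \<in> region K"
  shows "((\<lambda>y. V t y $ i) has_real_derivative d_x V (\<lambda>v. v $ i) t x) (at x)"
proof -
  have "((\<lambda>y. (t, y)) has_derivative (\<lambda>k. (0, k))) (at x)"
    by (auto intro!: derivative_eq_intros)
  from has_derivative_compose[OF this, of "\<lambda>(t, x). V t x $ i", OF component_derivative[OF assms],
      unfolded prod.case]
  show ?thesis by (rule has_derivative_imp_has_field_derivative) simp
qed

lemma component_tendsto_initial:
  assumes "x \<in> {-r<..<r}"
  shows "((\<lambda>t. V t x $ i) \<longlongrightarrow> V 0 x $ i) (at_right 0)"
proof -
  have "continuous_on {0..<T} (\<lambda>t. (\<lambda>(t, x). V t x $ i) (t, x))"
    using assms
    by (intro continuous_on_compose2[OF continuous_component] continuous_intros) (auto simp: \<Omega>_def)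
  then have "((\<lambda>t. V t x $ i) \<longlongrightarrow> V 0 x $ i) (at 0 within {0..<T})"
    using sizes by (simp add: continuous_on_def)
  then show ?thesis using at_within_Ico_at_right[of 0 T] sizes by simp
qed

lemma curve_tendsto: "(X w \<longlongrightarrow> 0) (at_right 0)"
proof -
  have "((\<lambda>t. X w t / t * t) \<longlongrightarrow> wave_speed w VL * 0) (at_right 0)"
    by (intro tendsto_mult curve_slope tendsto_ident_at)
  moreover have "\<forall>\<^sub>F t in at_right 0. X w t / t * t = X w t"
    using positive_times by eventually_elim simp
  ultimately show ?thesis using tendsto_cong by fastforce
qed

lemma lim_dx_RegL: "lim_dx RegL i = VL' $ i"
proof (rule space_derivative_limit_from_data[where f = "\<lambda>t x. V t x $ i" and a = "VL $ i"
      and J = "{-r<..<0}", OF _ _ _ _ component_space_derivative[where K = RegL] derivative_limits(2)])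
  show "0 islimpt {-r<..<0}" using sizes by (intro islimpt_greaterThanLessThan2) simp
  show "\<forall>\<^sub>F t in at_right 0. \<forall>z\<in>{x..y}. (t, z) \<in> region RegL"
    if "x \<in> {-r<..<0}" "y \<in> {-r<..<0}" for x y
    using eventually_conj[OF order_tendstoD(1)[OF curve_tendsto, of y Wave1] positive_times] that
    by (auto elim!: eventually_mono)
  show "((\<lambda>t. V t x $ i) \<longlongrightarrow> V 0 x $ i) (at_right 0)" if "x \<in> {-r<..<0}" for x
    using that sizes by (intro component_tendsto_initial) auto
qed (simp_all add: data_left)

lemma lim_dx_RegR: "lim_dx RegR i = VR' $ i"
proof (rule space_derivative_limit_from_data[where f = "\<lambda>t x. V t x $ i" and a = "VR $ i"
      and J = "{0<..<r}", OF _ _ _ _ component_space_derivative[where K = RegR] derivative_limits(2)])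
  show "0 islimpt {0<..<r}" using sizes by (intro islimpt_greaterThanLessThan1) simp
  show "\<forall>\<^sub>F t in at_right 0. \<forall>z\<in>{x..y}. (t, z) \<in> region RegR"
    if "x \<in> {0<..<r}" "y \<in> {0<..<r}" for x y
    using eventually_conj[OF order_tendstoD(2)[OF curve_tendsto, of x Wave6] positive_times] that
    by (auto elim!: eventually_mono)
  show "((\<lambda>t. V t x $ i) \<longlongrightarrow> V 0 x $ i) (at_right 0)" if "x \<in> {0<..<r}" for x
    using that sizes by (intro component_tendsto_initial) auto
qed (simp_all add: data_right)

text \<open>The source term has the same limit in all regions, so it drops out of every jump.\<close>

lemma potential_gradient_limit:
  "((\<lambda>(t, x). deriv W x) \<longlongrightarrow> deriv W 0) (at_origin K)"
proof -
  obtain D where D: "\<And>x. (W has_vector_derivative D x) (at x)" "continuous_on UNIV D"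
    using solution unfolding acoustic_GRP_solution_def C1_differentiable_on_def by auto
  then have "deriv W = D"
    by (auto simp: has_real_derivative_iff_has_vector_derivative[symmetric] DERIV_imp_deriv)
  then have "isCont (deriv W) 0"
    using D(2) by (simp add: continuous_on_eq_continuous_at)
  moreover have "(snd \<longlongrightarrow> (0::real)) (at_origin K)"
    using tendsto_snd[OF tendsto_ident_at, of "(0, 0) :: real \<times> real"] by simp
  ultimately show ?thesis
    using isCont_tendsto_compose[of 0 "deriv W" snd] by (simp add: case_prod_unfold)
qed

lemma limit_of_vanishing:
  fixes f :: "real \<Rightarrow> real \<Rightarrow> real"
  assumes "((\<lambda>(t, x). f t x) \<longlongrightarrow> l) (at_origin K)"
    and "\<And>t x. (t, x) \<in> region K \<Longrightarrow> f t x = 0"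
  shows "l = 0"
proof -
  have "\<forall>\<^sub>F z in at_origin K. (\<lambda>(t, x). f t x) z = 0"
    using assms(2) by (auto simp: eventually_at_filter intro!: always_eventually)
  then have "((\<lambda>(t, x). f t x) \<longlongrightarrow> 0) (at_origin K)"
    by (rule tendsto_eventually)
  then show ?thesis
    by (rule tendsto_unique[OF at_origin_nontrivial assms(1)])
qed

lemma limit_equations:
  "lim_D K 2 + 1 / rho VL * lim_dx K 4 = - (1/2) * deriv W 0"
  "lim_D K 3 + 1 / rho VL * lim_dx K 5 = 0"
  "lim_D K 4 + 3 * p11 VL * lim_dx K 2 = 0"
  "lim_D K 5 + 2 * p12 VL * lim_dx K 2 + p11 VL * lim_dx K 3 = 0"
  "lim_D K 6 + p22 VL * lim_dx K 2 + 2 * p12 VL * lim_dx K 3 = 0"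
proof -
  have eqs: "ten_moment_at W V t x" if "(t, x) \<in> region K" for t x
    using solution that unfolding acoustic_GRP_solution_def by blast
  note lims = lim_D_limit[of _ K, unfolded case_prod_unfold] derivative_limits(2)[of _ K, unfolded case_prod_unfold]
    state_tendsto[of _ K, unfolded case_prod_unfold] potential_gradient_limit[of K, unfolded case_prod_unfold]
  have r0: "rho VL \<noteq> 0" using states by simp
  note rules = tendsto_add tendsto_diff tendsto_mult tendsto_divide tendsto_const r0
  have "lim_D K 2 + 1 / rho VL * lim_dx K 4 - (- (1/2) * deriv W 0) = 0"
    by (rule limit_of_vanishing[where K = K and f = "\<lambda>t x. material V u1 t x
          + 1 / rho (V t x) * d_x V p11 t x - (- (1/2) * deriv W x)"])
      (unfold case_prod_unfold, intro lims rules, auto dest!: eqs simp: ten_moment_at_def)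
  then show "lim_D K 2 + 1 / rho VL * lim_dx K 4 = - (1/2) * deriv W 0" by simp
  show "lim_D K 3 + 1 / rho VL * lim_dx K 5 = 0"
    by (rule limit_of_vanishing[where K = K and f = "\<lambda>t x. material V u2 t x
          + 1 / rho (V t x) * d_x V p12 t x"])
      (unfold case_prod_unfold, intro lims rules, auto dest!: eqs simp: ten_moment_at_def)
  show "lim_D K 4 + 3 * p11 VL * lim_dx K 2 = 0"
    by (rule limit_of_vanishing[where K = K and f = "\<lambda>t x. material V p11 t x
          + 3 * p11 (V t x) * d_x V u1 t x"])
      (unfold case_prod_unfold, intro lims rules, auto dest!: eqs simp: ten_moment_at_def)
  show "lim_D K 5 + 2 * p12 VL * lim_dx K 2 + p11 VL * lim_dx K 3 = 0"
    by (rule limit_of_vanishing[where K = K and f = "\<lambda>t x. material V p12 t x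
          + 2 * p12 (V t x) * d_x V u1 t x + p11 (V t x) * d_x V u2 t x"])
      (unfold case_prod_unfold, intro lims rules, auto dest!: eqs simp: ten_moment_at_def)
  show "lim_D K 6 + p22 VL * lim_dx K 2 + 2 * p12 VL * lim_dx K 3 = 0"
    by (rule limit_of_vanishing[where K = K and f = "\<lambda>t x. material V p22 t x
          + p22 (V t x) * d_x V u1 t x + 2 * p12 (V t x) * d_x V u2 t x"])
      (unfold case_prod_unfold, intro lims rules, auto dest!: eqs simp: ten_moment_at_def)
qed

section \<open>The slopes and rates in the wave fan\<close>

abbreviation jump :: "wave \<Rightarrow> 6 \<Rightarrow> real" where
  "jump w i \<equiv> lim_dx (right_region w) i - lim_dx (left_region w) i"

abbreviation rel_speed :: "wave \<Rightarrow> real" where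
  "rel_speed w \<equiv> u1 VL - wave_speed w VL"

text \<open>The jump of \<open>\<partial>\<^sub>x V\<close> solves the eigenvector equation of the quasilinear system for the speed of
  the wave. These are its components for \<open>u\<^sub>1\<close>, \<open>u\<^sub>2\<close>, \<open>p\<^sub>1\<^sub>1\<close> and \<open>p\<^sub>1\<^sub>2\<close>.\<close>

lemma slope_jump_equations:
  "rho VL * rel_speed w * jump w 2 = - jump w 4"
  "rho VL * rel_speed w * jump w 3 = - jump w 5"
  "rel_speed w * jump w 4 = - 3 * p11 VL * jump w 2"
  "rel_speed w * jump w 5 = - 2 * p12 VL * jump w 2 - p11 VL * jump w 3"
proof -
  note eqs = limit_equations[of "right_region w"] limit_equations[of "left_region w"]
  have "rel_speed w * jump w 2 = - (jump w 4 / rho VL)"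
    using jump_relation[of w 2] eqs(1,6) by (simp add: diff_divide_distrib)
  then show "rho VL * rel_speed w * jump w 2 = - jump w 4"
    using states by (simp add: field_simps)
  have "rel_speed w * jump w 3 = - (jump w 5 / rho VL)"
    using jump_relation[of w 3] eqs(2,7) by (simp add: diff_divide_distrib)
  then show "rho VL * rel_speed w * jump w 3 = - jump w 5"
    using states by (simp add: field_simps)
  show "rel_speed w * jump w 4 = - 3 * p11 VL * jump w 2"
    using jump_relation[of w 4] eqs(3,8) by (simp add: algebra_simps)
  show "rel_speed w * jump w 5 = - 2 * p12 VL * jump w 2 - p11 VL * jump w 3"
    using jump_relation[of w 5] eqs(4,9) by (simp add: algebra_simps)
qed

lemma sound_speed_squared: "rho VL * c\<^sup>2 = 3 * p11 VL"
  using states by (simp add: sound_speed_def)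

text \<open>Eliminating the jump of \<open>\<partial>\<^sub>x p\<^sub>1\<^sub>1\<close> leaves \<open>(\<rho> (u\<^sub>1 - s)\<^sup>2 - 3 p\<^sub>1\<^sub>1)\<close> times the jump of \<open>\<partial>\<^sub>x u\<^sub>1\<close>: only the
  waves of speed \<open>u\<^sub>1 \<plusminus> c\<close> carry normal velocity and normal pressure.\<close>

lemma normal_jump_zero:
  assumes "rho VL * (rel_speed w)\<^sup>2 \<noteq> 3 * p11 VL"
  shows "jump w 2 = 0" "jump w 4 = 0"
proof -
  have "rho VL * (rel_speed w)\<^sup>2 * jump w 2 = rel_speed w * (rho VL * rel_speed w * jump w 2)"
    by (simp add: power2_eq_square)
  also have "\<dots> = 3 * p11 VL * jump w 2"
    unfolding slope_jump_equations(1) using slope_jump_equations(3)[of w] by (simp add: right_diff_distrib)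
  finally have "(rho VL * (rel_speed w)\<^sup>2 - 3 * p11 VL) * jump w 2 = 0"
    by (simp add: left_diff_distrib)
  then show "jump w 2 = 0" using assms by simp
  then show "jump w 4 = 0" using slope_jump_equations(1)[of w] by simp
qed

text \<open>Eliminating the jump of \<open>\<partial>\<^sub>x p\<^sub>1\<^sub>2\<close> leaves \<open>\<rho> (u\<^sub>1 - s)\<^sup>2 - p\<^sub>1\<^sub>1\<close>, here equal to \<open>2 p\<^sub>1\<^sub>1\<close>, times the jump
  of \<open>\<partial>\<^sub>x u\<^sub>2\<close>, balanced by \<open>2 p\<^sub>1\<^sub>2\<close> times the jump of \<open>\<partial>\<^sub>x u\<^sub>1\<close>.\<close>

lemma acoustic_shear_jump:
  assumes "rho VL * (rel_speed w)\<^sup>2 = 3 * p11 VL"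
  shows "p11 VL * jump w 3 = p12 VL * jump w 2"
proof -
  have "3 * p11 VL * jump w 3 = rel_speed w * (rho VL * rel_speed w * jump w 3)"
    unfolding assms[symmetric] by (simp add: power2_eq_square ac_simps)
  also have "\<dots> = 2 * p12 VL * jump w 2 + p11 VL * jump w 3"
    unfolding slope_jump_equations(2) using slope_jump_equations(4)[of w] by (simp add: right_diff_distrib)
  finally show ?thesis by simp
qed

text \<open>On the shear waves \<open>\<rho> (u\<^sub>1 - s)\<^sup>2\<close> equals \<open>p\<^sub>1\<^sub>1\<close>, on the contact it is zero.\<close>

lemma sonic_condition:
  "rho VL * (rel_speed Wave1)\<^sup>2 = 3 * p11 VL" "rho VL * (rel_speed Wave6)\<^sup>2 = 3 * p11 VL"
  "rho VL * (rel_speed Wave2)\<^sup>2 \<noteq> 3 * p11 VL" "rho VL * (rel_speed Wave5)\<^sup>2 \<noteq> 3 * p11 VL"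
  "rho VL * (rel_speed Contact)\<^sup>2 \<noteq> 3 * p11 VL"
  using sound_speed_squared states(3) by (simp_all add: power_divide)

lemma star_normal_derivatives:
  assumes "i = 2 \<or> i = 4"
  shows "lim_dx StarStarL i = lim_dx StarL i" "lim_dx StarStarR i = lim_dx StarL i" "lim_dx StarR i = lim_dx StarL i"
  using assms normal_jump_zero[OF sonic_condition(3)] normal_jump_zero[OF sonic_condition(4)]
    normal_jump_zero[OF sonic_condition(5)] by auto

lemma star_p11_rate:
  "lim_D StarStarL 4 = lim_D StarL 4" "lim_D StarStarR 4 = lim_D StarL 4" "lim_D StarR 4 = lim_D StarL 4"
  using limit_equations(3)[of StarL] limit_equations(3)[of StarStarL]
    limit_equations(3)[of StarStarR] limit_equations(3)[of StarR]
    star_normal_derivatives[of 2] by simp_all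

lemma u1_slope: "lim_dx K 2 = - lim_D K 4 / (3 * p11 VL)"
  using limit_equations(3)[of K] states by (simp add: field_simps)

text \<open>The contact only carries jumps of \<open>\<partial>\<^sub>x \<rho>\<close> and \<open>\<partial>\<^sub>x p\<^sub>2\<^sub>2\<close>, and it moves with the fluid, so that no
  material derivative jumps.\<close>

lemma contact_shear_continuous:
  "lim_dx StarStarR 3 = lim_dx StarStarL 3" "lim_dx StarStarR 5 = lim_dx StarStarL 5"
  using slope_jump_equations(2,4)[of Contact] normal_jump_zero[OF sonic_condition(5)] states by auto

lemma contact_rates_continuous:
  "lim_D StarStarR i = lim_D StarStarL i"
  using jump_relation[of Contact i] by simp

text \<open>The material derivative of \<open>u\<^sub>1\<close> at the origin is the same in the regions next to the two acoustic
  waves. Computing it from the left data through the first wave and from the right data through the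
  last one gives a linear equation for the common value of \<open>\<partial>\<^sub>x u\<^sub>1\<close>.\<close>

lemma p11_rate_from_data:
  "lim_D StarL 4 = 3 * p11 VL / (2 * c) *
    (1 / rho VL * (p11 VR' - p11 VL') - c * (u1 VL' + u1 VR'))"
proof -
  let ?B = "lim_dx StarL 2"
  have "lim_D StarR 2 = lim_D StarL 2"
    using limit_equations(1)[of StarL] limit_equations(1)[of StarR] star_normal_derivatives[of 4]
    by simp
  moreover have "lim_D StarL 2 - lim_D RegL 2 = c * (?B - u1 VL')"
    using jump_relation[of Wave1 2] by (simp add: lim_dx_RegL)
  moreover have "lim_D RegR 2 - lim_D StarR 2 = - c * (u1 VR' - ?B)"
    using jump_relation[of Wave6 2] star_normal_derivatives(3)[of 2] by (simp add: lim_dx_RegR)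
  moreover have "lim_D RegL 2 = - (1/2) * deriv W 0 - 1 / rho VL * p11 VL'"
    "lim_D RegR 2 = - (1/2) * deriv W 0 - 1 / rho VL * p11 VR'"
    using limit_equations(1)[of RegL] limit_equations(1)[of RegR] by (simp_all add: lim_dx_RegL lim_dx_RegR)
  ultimately have "1 / rho VL * (p11 VR' - p11 VL') - c * (u1 VL' + u1 VR') = - (2 * c) * ?B"
    by (simp add: algebra_simps)
  moreover have "lim_D StarL 4 = - 3 * p11 VL * ?B"
    using limit_equations(3)[of StarL] by simp
  ultimately show ?thesis using sound_speed_pos by simp
qed

text \<open>The three equations for \<open>p\<^sub>1\<^sub>1\<close>, \<open>p\<^sub>1\<^sub>2\<close>, \<open>p\<^sub>2\<^sub>2\<close> involve only the two space derivatives of the velocity, which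
  can therefore be eliminated within each region.\<close>

lemma p22_rate:
  "lim_D K 6 = (p11 VL * p22 VL - 4 * (p12 VL)\<^sup>2) / (3 * (p11 VL)\<^sup>2) * lim_D K 4
     + 2 * p12 VL / p11 VL * lim_D K 5"
proof -
  have rates: "lim_D K 6 = - p22 VL * lim_dx K 2 - 2 * p12 VL * lim_dx K 3"
    "lim_D K 5 = - 2 * p12 VL * lim_dx K 2 - p11 VL * lim_dx K 3"
    "lim_D K 4 = - 3 * p11 VL * lim_dx K 2"
    using limit_equations(3-5)[of K] by simp_all
  show ?thesis unfolding rates using states(3) by (simp add: field_simps power2_eq_square)
qed

lemma star_L_shear:
  "lim_dx StarL 3 = u2 VL' + p12 VL / p11 VL * (lim_dx StarL 2 - u1 VL')"
  and star_R_shear: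
  "lim_dx StarR 3 = u2 VR' + p12 VL / p11 VL * (lim_dx StarR 2 - u1 VR')"
proof -
  show "lim_dx StarL 3 = u2 VL' + p12 VL / p11 VL * (lim_dx StarL 2 - u1 VL')"
    using acoustic_shear_jump[OF sonic_condition(1)] states by (simp add: lim_dx_RegL field_simps)
  show "lim_dx StarR 3 = u2 VR' + p12 VL / p11 VL * (lim_dx StarR 2 - u1 VR')"
    using acoustic_shear_jump[OF sonic_condition(2)] states by (simp add: lim_dx_RegR field_simps)
qed

lemma star_L_u2_rate:
  "lim_D StarL 3 = - p12 VL' / rho VL - c * p12 VL / p11 VL * u1 VL'
     - p12 VL * c / (3 * (p11 VL)\<^sup>2) * lim_D StarL 4"
proof -
  have "lim_D StarL 3 = lim_D RegL 3 + c * (p12 VL / p11 VL * (lim_dx StarL 2 - u1 VL'))"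
    using jump_relation[of Wave1 3] by (simp add: star_L_shear lim_dx_RegL)
  moreover have "lim_D RegL 3 = - p12 VL' / rho VL"
    using limit_equations(2)[of RegL] by (simp add: lim_dx_RegL)
  ultimately show ?thesis
    by (simp add: u1_slope right_diff_distrib power2_eq_square ac_simps)
qed

lemma star_R_u2_rate:
  "lim_D StarR 3 = - p12 VR' / rho VR + c * p12 VR / p11 VL * u1 VR'
     + p12 VL * c / (3 * (p11 VL)\<^sup>2) * lim_D StarL 4"
proof -
  have "lim_D StarR 3 = lim_D RegR 3 - c * (p12 VL / p11 VL * (lim_dx StarR 2 - u1 VR'))"
    using jump_relation[of Wave6 3] by (simp add: star_R_shear lim_dx_RegR algebra_simps)
  moreover have "lim_D RegR 3 = - p12 VR' / rho VL"
    using limit_equations(2)[of RegR] by (simp add: lim_dx_RegR)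
  ultimately show ?thesis
    by (simp add: u1_slope star_p11_rate states(1) right_diff_distrib power2_eq_square ac_simps)
qed

lemma star_p12_rate:
  "lim_D StarL 5 = p12 VL / p11 VL * lim_D StarL 4 + p12 VL * u1 VL' - p11 VL * u2 VL'"
  "lim_D StarR 5 = p12 VL / p11 VL * lim_D StarL 4 + p12 VR * u1 VR' - p11 VR * u2 VR'"
proof -
  have shear: "p11 VL * lim_dx StarL 3 = p11 VL * u2 VL' + p12 VL * (lim_dx StarL 2 - u1 VL')"
    "p11 VL * lim_dx StarR 3 = p11 VL * u2 VR' + p12 VL * (lim_dx StarR 2 - u1 VR')"
    unfolding star_L_shear star_R_shear using states(3) by (simp_all add: distrib_left)
  have "p12 VL / p11 VL * lim_D StarL 4 = - 3 * p12 VL * lim_dx StarL 2"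
  proof -
    have "lim_D StarL 4 = - 3 * p11 VL * lim_dx StarL 2" using limit_equations(3)[of StarL] by simp
    then show ?thesis using states(3) by simp
  qed
  then show "lim_D StarL 5 = p12 VL / p11 VL * lim_D StarL 4 + p12 VL * u1 VL' - p11 VL * u2 VL'"
    "lim_D StarR 5 = p12 VL / p11 VL * lim_D StarL 4 + p12 VR * u1 VR' - p11 VR * u2 VR'"
    using limit_equations(4)[of StarL] limit_equations(4)[of StarR] shear
      star_normal_derivatives(3)[of 2]
    by (simp_all only: states(1)) (simp_all add: right_diff_distrib)
qed

lemma star_p22_slope:
  "lim_dx StarL 6 = 1 / c * (lim_D StarL 6 + p22 VL * u1 VL' + 2 * p12 VL * u2 VL' + c * p22 VL')"
  "lim_dx StarR 6 = 1 / c * (- p22 VR * u1 VR' - 2 * p12 VR * u2 VR' + c * p22 VR' - lim_D StarR 6)"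
  using jump_relation[of Wave1 6] limit_equations(5)[of RegL]
    jump_relation[of Wave6 6] limit_equations(5)[of RegR] sound_speed_pos
  by (simp_all add: lim_dx_RegL lim_dx_RegR states(1) field_simps)

text \<open>Across a shear wave the jump of \<open>\<partial>\<^sub>x u\<^sub>1\<close> vanishes, so the jumps of \<open>D u\<^sub>2\<close> and \<open>D p\<^sub>1\<^sub>2\<close> are both multiples
  of the jump of \<open>\<partial>\<^sub>x u\<^sub>2\<close>. The combination \<open>D u\<^sub>2 \<plusminus> c / (\<surd>3 p\<^sub>1\<^sub>1) D p\<^sub>1\<^sub>2\<close> that is continuous across one
  of the two shear waves is continuous across the contact as well; two such relations determine
  both rates between the shear waves.\<close>

lemma shear_invariants:
  "lim_D StarStarL 3 - lim_D StarL 3 = - (c / (sqrt 3 * p11 VL)) * (lim_D StarStarL 5 - lim_D StarL 5)"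
  "lim_D StarStarL 3 - lim_D StarR 3 = c / (sqrt 3 * p11 VL) * (lim_D StarStarL 5 - lim_D StarR 5)"
proof -
  have "lim_D (right_region w) 5 - lim_D (left_region w) 5 = - p11 VL * jump w 3"
    if "jump w 2 = 0" for w
    using jump_relation[of w 5] slope_jump_equations(4)[of w] that by simp
  from this[of Wave2] this[of Wave5]
  have p12: "lim_D StarStarL 5 - lim_D StarL 5 = - p11 VL * (lim_dx StarStarL 3 - lim_dx StarL 3)"
    "lim_D StarR 5 - lim_D StarStarL 5 = - p11 VL * (lim_dx StarR 3 - lim_dx StarStarL 3)"
    using star_normal_derivatives[of 2]
    by (simp_all add: contact_rates_continuous contact_shear_continuous)
  have u2: "lim_D StarStarL 3 - lim_D StarL 3 = c / sqrt 3 * (lim_dx StarStarL 3 - lim_dx StarL 3)"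
    "lim_D StarR 3 - lim_D StarStarL 3 = - (c / sqrt 3) * (lim_dx StarR 3 - lim_dx StarStarL 3)"
    using jump_relation[of Wave2 3] jump_relation[of Wave5 3]
    by (simp_all add: contact_rates_continuous contact_shear_continuous)
  show "lim_D StarStarL 3 - lim_D StarL 3 = - (c / (sqrt 3 * p11 VL)) * (lim_D StarStarL 5 - lim_D StarL 5)"
    unfolding u2 p12 using states(3) by simp
  have "lim_D StarR 3 - lim_D StarStarL 3 = c / (sqrt 3 * p11 VL) * (lim_D StarR 5 - lim_D StarStarL 5)"
    unfolding u2 p12 using states(3) by simp
  then show "lim_D StarStarL 3 - lim_D StarR 3 = c / (sqrt 3 * p11 VL) * (lim_D StarStarL 5 - lim_D StarR 5)"
    by (simp add: algebra_simps)
qed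

lemma double_star_rates:
  "lim_D StarStarL 3 = 1/2 * (lim_D StarL 3 + lim_D StarR 3
     + c / (sqrt 3 * p11 VL) * (lim_D StarL 5 - lim_D StarR 5))"
  "lim_D StarStarL 5 = sqrt 3 * p11 VL / (2 * c) * (lim_D StarL 3 - lim_D StarR 3
     + c / (sqrt 3 * p11 VL) * (lim_D StarL 5 + lim_D StarR 5))"
proof -
  define m where "m = c / (sqrt 3 * p11 VL)"
  have m: "m > 0" using sound_speed_pos states by (simp add: m_def)
  note inv = shear_invariants[folded m_def]
  have "2 * lim_D StarStarL 3 = lim_D StarL 3 + lim_D StarR 3 + m * (lim_D StarL 5 - lim_D StarR 5)"
    using inv by (simp add: algebra_simps)
  then show "lim_D StarStarL 3 = 1/2 * (lim_D StarL 3 + lim_D StarR 3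
     + c / (sqrt 3 * p11 VL) * (lim_D StarL 5 - lim_D StarR 5))" by (simp add: m_def)
  have "2 * m * lim_D StarStarL 5 = lim_D StarL 3 - lim_D StarR 3 + m * (lim_D StarL 5 + lim_D StarR 5)"
    using inv by (simp add: algebra_simps)
  then have "lim_D StarStarL 5 = 1 / (2 * m) * (lim_D StarL 3 - lim_D StarR 3 + m * (lim_D StarL 5 + lim_D StarR 5))"
    using m by (simp add: field_simps)
  then show "lim_D StarStarL 5 = sqrt 3 * p11 VL / (2 * c) * (lim_D StarL 3 - lim_D StarR 3
     + c / (sqrt 3 * p11 VL) * (lim_D StarL 5 + lim_D StarR 5))"
    by (simp add: m_def)
qed

lemma double_star_p22_slope:
  "lim_dx StarStarL 6 = sqrt 3 / c * (lim_D StarStarL 6 - lim_D StarL 6) + lim_dx StarL 6"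
  "lim_dx StarStarR 6 = lim_dx StarR 6 + sqrt 3 / c * (lim_D StarR 6 - lim_D StarStarL 6)"
  using jump_relation[of Wave2 6] jump_relation[of Wave5 6] sound_speed_pos
  by (simp_all add: contact_rates_continuous field_simps)

lemma double_star_time_derivatives:
  "lim_dt StarStarL 3 = lim_D StarStarL 3
     + u1 VL / p11 VL * (lim_D StarStarL 5 - 2 * p12 VL / (3 * p11 VL) * lim_D StarL 4)"
  "lim_dt StarStarL 5 = lim_D StarStarL 5 + rho VL * u1 VL * lim_D StarStarL 3"
proof -
  have "lim_dx StarStarL 3 = - 1 / p11 VL * (lim_D StarStarL 5 - 2 * p12 VL / (3 * p11 VL) * lim_D StarL 4)"
    using limit_equations(4)[of StarStarL] states star_p11_rate(1)
    by (simp add: u1_slope field_simps)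
  then show "lim_dt StarStarL 3 = lim_D StarStarL 3
     + u1 VL / p11 VL * (lim_D StarStarL 5 - 2 * p12 VL / (3 * p11 VL) * lim_D StarL 4)"
    using lim_D_eq[of StarStarL 3] by simp
  have "lim_dx StarStarL 5 = - rho VL * lim_D StarStarL 3"
    using limit_equations(2)[of StarStarL] states by (simp add: field_simps)
  then show "lim_dt StarStarL 5 = lim_D StarStarL 5 + rho VL * u1 VL * lim_D StarStarL 3"
    using lim_D_eq[of StarStarL 5] by simp
qed

lemma contact_time_derivatives_continuous:
  assumes "i = 3 \<or> i = 5"
  shows "lim_dt StarStarR i = lim_dt StarStarL i"
  using lim_D_eq[of StarStarR i] lim_D_eq[of StarStarL i] contact_rates_continuous[of i]
    contact_shear_continuous assms by auto

end

theorem theorem5p27: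
  fixes W :: "real \<Rightarrow> real" and VL VL' VR VR' Vs :: state and T r cs :: real
    and X :: "wave \<Rightarrow> real \<Rightarrow> real" and V :: "real \<Rightarrow> real \<Rightarrow> state"
    and olim :: "region \<Rightarrow> (real \<Rightarrow> real \<Rightarrow> real) \<Rightarrow> real"
  assumes "acoustic_GRP_solution W VL VL' VR VR' T r X V"
    and "Vs = VL" and "Vs = VR" and "cs = sound_speed Vs"
    and "olim = origin_limit T r X"
  shows "\<exists>Dp11_s Du2_ss Dp12_ss Dp22_ss u2t_ss p12t_ss.
     \<comment> \<open>the common limits, subscripts * and **\<close>
     (\<forall>K\<in>{StarL, StarStarL, StarStarR, StarR}. olim K (material V p11) = Dp11_s) \<and>
     (\<forall>K\<in>{StarStarL, StarStarR}.
        olim K (material V u2) = Du2_ss \<and> olim K (material V p12) = Dp12_ss \<and>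
        olim K (material V p22) = Dp22_ss \<and>
        olim K (d_t V u2) = u2t_ss \<and> olim K (d_t V p12) = p12t_ss) \<and>
     \<comment> \<open>time derivatives in the ** regions\<close>
     u2t_ss = Du2_ss + u1 Vs / p11 Vs * (Dp12_ss - 2 * p12 Vs / (3 * p11 Vs) * Dp11_s) \<and>
     p12t_ss = Dp12_ss + rho Vs * u1 Vs * Du2_ss \<and>
     (\<forall>K\<in>{StarStarL, StarStarR}. olim K (d_t V p22) = Dp22_ss - u1 Vs * olim K (d_x V p22)) \<and>
     Dp22_ss = (p11 Vs * p22 Vs - 4 * (p12 Vs)\<^sup>2) / (3 * (p11 Vs)\<^sup>2) * Dp11_s
               + 2 * p12 Vs / p11 Vs * Dp12_ss \<and>
     Du2_ss = 1/2 * (olim StarL (material V u2) + olim StarR (material V u2)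
               + cs / (sqrt 3 * p11 Vs) * (olim StarL (material V p12) - olim StarR (material V p12))) \<and>
     Dp12_ss = sqrt 3 * p11 Vs / (2 * cs) * (olim StarL (material V u2) - olim StarR (material V u2)
               + cs / (sqrt 3 * p11 Vs) * (olim StarL (material V p12) + olim StarR (material V p12))) \<and>
     olim StarStarL (d_x V p22) =
       sqrt 3 / cs * (Dp22_ss - olim StarL (material V p22)) + olim StarL (d_x V p22) \<and>
     olim StarStarR (d_x V p22) =
       olim StarR (d_x V p22) + sqrt 3 / cs * (olim StarR (material V p22) - Dp22_ss) \<and>
     Dp11_s = 3 * p11 Vs / (2 * cs) *
       (1 / rho Vs * (p11 VR' - p11 VL') - cs * (u1 VL' + u1 VR')) \<and>
     \<comment> \<open>the limits in the regions *L and *R, expressed by the data\<close>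
     olim StarL (material V u2) = - p12 VL' / rho VL - cs * p12 VL / p11 Vs * u1 VL'
       - p12 Vs * cs / (3 * (p11 Vs)\<^sup>2) * Dp11_s \<and>
     olim StarR (material V u2) = - p12 VR' / rho VR + cs * p12 VR / p11 Vs * u1 VR'
       + p12 Vs * cs / (3 * (p11 Vs)\<^sup>2) * Dp11_s \<and>
     (\<forall>(K, VK, VK')\<in>{(StarL, VL, VL'), (StarR, VR, VR')}.
        olim K (material V p12) = p12 Vs / p11 Vs * Dp11_s + p12 VK * u1 VK' - p11 VK * u2 VK' \<and>
        olim K (material V p22) = (p11 Vs * p22 Vs - 4 * (p12 Vs)\<^sup>2) / (3 * (p11 Vs)\<^sup>2) * Dp11_s
          + 2 * p12 Vs / p11 Vs * olim K (material V p12)) \<and>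
     olim StarL (d_x V p22) = 1 / cs * (olim StarL (material V p22) + p22 VL * u1 VL'
       + 2 * p12 VL * u2 VL' + cs * p22 VL') \<and>
     olim StarR (d_x V p22) = 1 / cs * (- p22 VR * u1 VR' - 2 * p12 VR * u2 VR'
       + cs * p22 VR' - olim StarR (material V p22))"
proof -
  interpret acoustic_GRP W VL VL' VR VR' T r X V
    by unfold_locales (rule assms(1))
  have olim: "olim K (material V (\<lambda>v. v $ i)) = lim_D K i" "olim K (d_t V (\<lambda>v. v $ i)) = lim_dt K i"
    "olim K (d_x V (\<lambda>v. v $ i)) = lim_dx K i" for K i
    by (simp_all add: assms(5) lim_D_def lim_dt_def lim_dx_def)
  note Vs = \<open>Vs = VL\<close> and cs = \<open>cs = sound_speed Vs\<close>
  have Dp11: "\<forall>K\<in>{StarL, StarStarL, StarStarR, StarR}. lim_D K 4 = lim_D StarL 4"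
    by (simp add: star_p11_rate)
  have common: "\<forall>K\<in>{StarStarL, StarStarR}.
      lim_D K 3 = lim_D StarStarL 3 \<and> lim_D K 5 = lim_D StarStarL 5 \<and> lim_D K 6 = lim_D StarStarL 6 \<and>
      lim_dt K 3 = lim_dt StarStarL 3 \<and> lim_dt K 5 = lim_dt StarStarL 5"
    by (simp add: contact_rates_continuous contact_time_derivatives_continuous)
  have p22t: "\<forall>K\<in>{StarStarL, StarStarR}. lim_dt K 6 = lim_D StarStarL 6 - u1 VL * lim_dx K 6"
    using lim_D_eq[of StarStarL 6] lim_D_eq[of StarStarR 6] by (simp add: contact_rates_continuous)
  have star: "\<forall>(K, VK, VK')\<in>{(StarL, VL, VL'), (StarR, VR, VR')}.
      lim_D K 5 = p12 VL / p11 VL * lim_D StarL 4 + p12 VK * u1 VK' - p11 VK * u2 VK' \<and>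
      lim_D K 6 = (p11 VL * p22 VL - 4 * (p12 VL)\<^sup>2) / (3 * (p11 VL)\<^sup>2) * lim_D StarL 4
        + 2 * p12 VL / p11 VL * lim_D K 5"
    using star_p12_rate p22_rate[of StarL] p22_rate[of StarR] by (simp add: star_p11_rate)
  show ?thesis
    unfolding olim cs Vs
    by (rule exI[of _ "lim_D StarL 4"], rule exI[of _ "lim_D StarStarL 3"],
        rule exI[of _ "lim_D StarStarL 5"], rule exI[of _ "lim_D StarStarL 6"],
        rule exI[of _ "lim_dt StarStarL 3"], rule exI[of _ "lim_dt StarStarL 5"])
      (intro conjI Dp11 common p22t star double_star_rates double_star_time_derivatives
        p11_rate_from_data p22_rate[of StarStarL, unfolded star_p11_rate]
        double_star_p22_slope star_L_u2_rate star_R_u2_rate star_p22_slope)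
qed

end
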